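(* Let $f(x)=a_nx^n+\dots+a_0$ be a polynomial of degree $n\ge1$ with integer coefficients that is expansive, and let $\alpha$ be any root of $f$. Then \[ \frac{1}{|\alpha|-1}\le\begin{cases}nL(f)+n & \text{if }\alpha\in\mathbb{R},\\ 2\binom{n}{2}L(f)^{n-1}+2\binom{n}{2}+1 & \text{if }\alpha\in\mathbb{C}\setminus\mathbb{R}.\end{cases}\]
   Context: A polynomial is expansive if all of its complex roots $\alpha$ satisfy $|\alpha|>1$. The length of $f$ is $L(f)=\sum_{i=0}^n|a_i|$. *)

theory Defs
  imports "HOL-Analysis.Analysis" "HOL-Computational_Algebra.Computational_Algebra"
begin

definition expansive :: "complex poly \<Rightarrow> bool" where
  "expansive p \<longleftrightarrow> (\<forall>z. poly p z = 0 \<longrightarrow> norm z > 1)"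

definition poly_length :: "int poly \<Rightarrow> int" where
  "poly_length f = (\<Sum>i\<le>degree f. \<bar>coeff f i\<bar>)"

end

theory Submission
  imports Defs "HOL-Computational_Algebra.Field_as_Ring" "Jordan_Normal_Form.Determinant"
begin

text \<open>
  In each case a nonzero integer is bounded above by a multiple of a quantity that vanishes at
  \<open>|\<alpha>| = 1\<close>.

  For real \<open>\<alpha>\<close> the integer is the value at \<open>sgn \<alpha>\<close> of the reflected polynomial \<open>x\<^bsup>n\<^esup> f(1/x)\<close>: this
  polynomial vanishes at \<open>1/\<alpha>\<close> and has Lipschitz constant \<open>n L(f)\<close> on the unit disc.

  For nonreal \<open>\<alpha>\<close> put \<open>d = n - 1\<close> and let \<open>T\<close> be the matrix of the linear map
  \<open>U \<mapsto> ([x\<^bsup>k\<^esup>] f U - [x\<^bsup>2d-k\<^esup>] f U)\<^bsub>k<d\<^esub>\<close> on polynomials of degree less than \<open>d\<close>; the integer is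
  \<open>det T\<close>. It is nonzero: a kernel vector makes \<open>f U\<close> palindromic, so \<open>f\<close> divides the product
  of a power of \<open>x\<close> and the reflections of \<open>f\<close> and \<open>U\<close>. The first two factors are coprime to
  \<open>f\<close>, and the third has smaller degree than \<open>f\<close>. It is small: with
  \<open>f = (x - \<alpha>) (x - cnj \<alpha>) h\<close> and \<open>t = |\<alpha>|\<^sup>2\<close>, the polynomial \<open>U = x\<^bsup>n-2\<^esup> h(t/x)\<close> satisfies
  \<open>[x\<^bsup>k\<^esup>] f U = t\<^bsup>d-k\<^esup> [x\<^bsup>2d-k\<^esup>] f U\<close>, so the entries of \<open>T U\<close> are at most
  \<open>(d - k) (1 - 1/t) L(f) max |U\<^sub>i|\<close>. As the columns of \<open>T\<close> have absolute sum at most \<open>L(f)\<close>,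
  Cramer's rule for the largest coefficient of \<open>U\<close> gives
  \<open>|det T| \<le> (n choose 2) L(f)\<^bsup>d\<^esup> (1 - 1/t)\<close>.
\<close>

no_notation fps_nth (infixl "$" 75) and vec_nth (infixl "$" 90)
hide_const (open) Determinants.det Module.smult

section \<open>The sum of the norms of the coefficients\<close>

definition poly_l1_norm :: "'a::real_normed_vector poly \<Rightarrow> real" where
  "poly_l1_norm p = (\<Sum>i\<le>degree p. norm (coeff p i))"

lemma poly_l1_norm_eq_sum:
  assumes "degree p \<le> n"
  shows "poly_l1_norm p = (\<Sum>i\<le>n. norm (coeff p i))"
  unfolding poly_l1_norm_def
  by (rule sum.mono_neutral_left) (use assms in \<open>auto simp: coeff_eq_0\<close>)

lemma sum_norm_coeff_le_poly_l1_norm: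
  assumes "finite A"
  shows "(\<Sum>i\<in>A. norm (coeff p i)) \<le> poly_l1_norm p"
proof -
  have "(\<Sum>i\<in>A. norm (coeff p i)) = (\<Sum>i\<in>A \<inter> {..degree p}. norm (coeff p i))"
    using assms by (intro sum.mono_neutral_right) (auto simp: coeff_eq_0 not_le)
  also have "\<dots> \<le> poly_l1_norm p"
    unfolding poly_l1_norm_def by (intro sum_mono2) auto
  finally show ?thesis .
qed

lemma poly_l1_norm_map_poly_of_int:
  "poly_l1_norm (map_poly of_int f :: 'a::real_normed_field poly) = of_int (poly_length f)"
  by (simp add: poly_l1_norm_def poly_length_def degree_map_poly coeff_map_poly)

lemma poly_l1_norm_monom_mult:
  fixes p :: "'a::real_normed_field poly"
  shows "poly_l1_norm (monom 1 m * p) = poly_l1_norm p"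
proof -
  have "degree (monom 1 m * p) \<le> m + degree p"
    using degree_mult_le[of "monom 1 m" p] by (simp add: degree_monom_eq)
  then have "poly_l1_norm (monom 1 m * p) = (\<Sum>i\<le>m + degree p. norm (coeff (monom 1 m * p) i))"
    by (rule poly_l1_norm_eq_sum)
  also have "\<dots> = (\<Sum>i\<in>{m..m + degree p}. norm (coeff p (i - m)))"
    by (intro sum.mono_neutral_cong_right) (auto simp: coeff_monom_mult)
  also have "\<dots> = poly_l1_norm p"
    unfolding poly_l1_norm_def
    by (rule sum.reindex_bij_witness[of _ "\<lambda>i. i + m" "\<lambda>i. i - m"]) auto
  finally show ?thesis .
qed

lemma poly_l1_norm_reflect_poly: "poly_l1_norm (reflect_poly p) = poly_l1_norm p"
proof -
  have "poly_l1_norm (reflect_poly p) = (\<Sum>i\<le>degree p. norm (coeff p (degree p - i)))"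
    by (simp add: poly_l1_norm_eq_sum[OF degree_reflect_poly_le] coeff_reflect_poly)
  also have "\<dots> = poly_l1_norm p"
    unfolding poly_l1_norm_def
    by (rule sum.reindex_bij_witness[of _ "\<lambda>i. degree p - i" "\<lambda>i. degree p - i"]) auto
  finally show ?thesis .
qed

lemma obtains_coeff_of_maximal_norm:
  fixes p :: "'a::real_normed_vector poly"
  obtains j where "j \<le> degree p" "\<And>i. norm (coeff p i) \<le> norm (coeff p j)"
proof -
  let ?N = "(\<lambda>i. norm (coeff p i)) ` {..degree p}"
  have "Max ?N \<in> ?N" by (intro Max_in) auto
  then obtain j where j: "j \<le> degree p" "norm (coeff p j) = Max ?N"
    by (metis (no_types, lifting) atMost_iff imageE)
  then have "norm (coeff p i) \<le> norm (coeff p j)" if "i \<le> degree p" for i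
    using that by simp
  then have "norm (coeff p i) \<le> norm (coeff p j)" for i
    by (cases "i \<le> degree p") (simp_all add: coeff_eq_0)
  with j(1) show thesis by (rule that)
qed

lemma norm_coeff_mult_le:
  fixes p q :: "'a::real_normed_field poly"
  assumes "\<And>i. norm (coeff q i) \<le> M"
  shows "norm (coeff (p * q) k) \<le> poly_l1_norm p * M"
proof -
  have "0 \<le> M" using assms[of 0] norm_ge_zero order_trans by blast
  have "norm (coeff (p * q) k) \<le> (\<Sum>i\<le>k. norm (coeff p i) * M)"
    unfolding coeff_mult
    by (rule sum_norm_le) (simp add: norm_mult mult_left_mono assms)
  also have "\<dots> = (\<Sum>i\<le>k. norm (coeff p i)) * M"
    by (simp add: sum_distrib_right)
  also have "\<dots> \<le> poly_l1_norm p * M"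
    using \<open>0 \<le> M\<close> by (intro mult_right_mono sum_norm_coeff_le_poly_l1_norm) auto
  finally show ?thesis .
qed

lemma norm_poly_diff_le:
  fixes p :: "'a::real_normed_field poly"
  assumes "norm z \<le> 1" "norm w \<le> 1"
  shows "norm (poly p z - poly p w) \<le> real (degree p) * poly_l1_norm p * norm (z - w)"
proof -
  have "norm (poly p z - poly p w) = norm (\<Sum>i\<le>degree p. coeff p i * (z ^ i - w ^ i))"
    by (simp add: poly_altdef sum_subtractf right_diff_distrib)
  also have "\<dots> \<le> (\<Sum>i\<le>degree p. norm (coeff p i) * (real (degree p) * norm (z - w)))"
  proof (rule sum_norm_le)
    fix i assume "i \<in> {..degree p}"
    then have "real i * norm (z - w) \<le> real (degree p) * norm (z - w)"
      by (intro mult_right_mono) auto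
    then have "norm (z ^ i - w ^ i) \<le> real (degree p) * norm (z - w)"
      using norm_power_diff[OF assms, of i] by linarith
    then show "norm (coeff p i * (z ^ i - w ^ i))
        \<le> norm (coeff p i) * (real (degree p) * norm (z - w))"
      by (simp add: norm_mult mult_left_mono)
  qed
  also have "\<dots> = real (degree p) * poly_l1_norm p * norm (z - w)"
    by (simp add: poly_l1_norm_def flip: sum_distrib_right)
  finally show ?thesis .
qed

section \<open>Determinants and column sums\<close>

lemma mat_delete_column_sum_le:
  fixes A :: "'a::real_normed_vector mat"
  assumes A: "A \<in> carrier_mat (Suc d) (Suc d)" and i: "i < Suc d" and "j < d"
  shows "(\<Sum>k<d. norm (mat_delete A i 0 $$ (k, j))) \<le> (\<Sum>k<Suc d. norm (A $$ (k, Suc j)))"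
proof -
  have "(\<Sum>k<d. norm (mat_delete A i 0 $$ (k, j)))
      = (\<Sum>k\<in>{0..<d}. norm (A $$ (insert_index i k, Suc j)))"
    using \<open>j < d\<close> mat_delete_index[OF A i, of 0] by (simp add: atLeast0LessThan)
  also have "\<dots> = (\<Sum>k\<in>{0..<Suc d} - {i}. norm (A $$ (k, Suc j)))"
    by (simp add: insert_index_image[OF i, symmetric] sum.reindex insert_index_inj_on)
  also have "\<dots> \<le> (\<Sum>k<Suc d. norm (A $$ (k, Suc j)))" by (intro sum_mono2) auto
  finally show ?thesis .
qed

lemma norm_det_le_prod_column_sums:
  fixes A :: "'a::real_normed_field mat"
  assumes "A \<in> carrier_mat d d"
  shows "norm (det A) \<le> (\<Prod>j<d. \<Sum>i<d. norm (A $$ (i, j)))"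
  using assms
proof (induction d arbitrary: A)
  case 0
  then show ?case by simp
next
  case (Suc d)
  let ?S = "\<lambda>j. \<Sum>i<Suc d. norm (A $$ (i, j))"
  have minor: "norm (det (mat_delete A i 0)) \<le> (\<Prod>j<d. ?S (Suc j))" if i: "i < Suc d" for i
  proof -
    have "(\<Prod>j<d. \<Sum>k<d. norm (mat_delete A i 0 $$ (k, j))) \<le> (\<Prod>j<d. ?S (Suc j))"
      using mat_delete_column_sum_le[OF Suc.prems i] by (intro prod_mono conjI sum_nonneg) auto
    moreover have "mat_delete A i 0 \<in> carrier_mat d d"
      using mat_delete_carrier[OF Suc.prems] by simp
    ultimately show ?thesis using Suc.IH by (meson order_trans)
  qed
  have "norm (det A) = norm (\<Sum>i<Suc d. A $$ (i, 0) * cofactor A i 0)"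
    using laplace_expansion_column[OF Suc.prems, of 0] by simp
  also have "\<dots> \<le> (\<Sum>i<Suc d. norm (A $$ (i, 0)) * (\<Prod>j<d. ?S (Suc j)))"
    by (rule sum_norm_le)
       (use minor in \<open>simp add: cofactor_def norm_mult norm_power mult_left_mono\<close>)
  also have "\<dots> = (\<Prod>j<Suc d. ?S j)"
    by (simp only: prod.lessThan_Suc_shift sum_distrib_right)
  finally show ?case .
qed

lemma norm_vec_index_mult_det_le:
  fixes A :: "'a::real_normed_field mat"
  assumes A: "A \<in> carrier_mat d d" and v: "v \<in> carrier_vec d" and j: "j < d"
    and columns: "\<And>m. m < d \<Longrightarrow> (\<Sum>k<d. norm (A $$ (k, m))) \<le> L"
  shows "norm (v $ j) * norm (det A) \<le> (\<Sum>k<d. norm ((A *\<^sub>v v) $ k)) * L ^ (d - 1)"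
proof -
  let ?B = "replace_col A (A *\<^sub>v v) j"
  have B: "?B $$ (k, m) = (if m = j then (A *\<^sub>v v) $ k else A $$ (k, m))"
    if "k < d" "m < d" for k m
    using that A by (simp add: replace_col_def)
  have "norm (v $ j) * norm (det A) = norm (det ?B)"
    by (simp add: cramer_lemma_mat[OF A v j] norm_mult)
  also have "\<dots> \<le> (\<Prod>m<d. \<Sum>k<d. norm (?B $$ (k, m)))"
    using A by (intro norm_det_le_prod_column_sums) (simp add: replace_col_def)
  also have "\<dots> = (\<Sum>k<d. norm (?B $$ (k, j))) * (\<Prod>m\<in>{..<d} - {j}. \<Sum>k<d. norm (?B $$ (k, m)))"
    using j by (subst prod.remove[of _ j]) auto
  also have "\<dots> \<le> (\<Sum>k<d. norm ((A *\<^sub>v v) $ k)) * (\<Prod>m\<in>{..<d} - {j}. L)"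
    using j columns by (intro mult_mono prod_mono conjI sum_nonneg prod_nonneg) (auto simp: B)
  also have "(\<Prod>m\<in>{..<d} - {j}. L) = L ^ (d - 1)"
    using j by simp
  finally show ?thesis .
qed

section \<open>Palindromic products and the Jury matrix\<close>

definition scaled_palindromic :: "'a::comm_semiring_1 \<Rightarrow> nat \<Rightarrow> 'a poly \<Rightarrow> bool" where
  "scaled_palindromic t d p \<longleftrightarrow> (\<forall>k\<le>d. coeff p k = t ^ (d - k) * coeff p (2 * d - k))"

definition jury_mat :: "'a::comm_ring_1 poly \<Rightarrow> nat \<Rightarrow> 'a mat" where
  "jury_mat f d = mat d d
     (\<lambda>(k, m). coeff (monom 1 m * f) k - coeff (monom 1 m * f) (2 * d - k))"

lemma jury_mat_carrier [simp]: "jury_mat f d \<in> carrier_mat d d"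
  by (simp add: jury_mat_def)

lemma jury_mat_map_poly_of_int:
  "jury_mat (map_poly of_int f) d = map_mat of_int (jury_mat f d)"
  by (rule eq_matI) (auto simp: jury_mat_def coeff_monom_mult coeff_map_poly)

lemma coeff_mult_eq_sum_monom:
  fixes f U :: "'a::comm_semiring_1 poly"
  assumes "degree U < d"
  shows "coeff (f * U) k = (\<Sum>m<d. coeff (monom 1 m * f) k * coeff U m)"
proof -
  have "U = (\<Sum>m<d. smult (coeff U m) (monom 1 m))"
    using poly_as_sum_of_monoms'[of U "d - 1"] assms
    by (cases d) (simp_all add: smult_monom lessThan_Suc_atMost)
  then have "f * U = f * (\<Sum>m<d. smult (coeff U m) (monom 1 m))"
    by (rule arg_cong)
  also have "\<dots> = (\<Sum>m<d. smult (coeff U m) (monom 1 m * f))"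
    by (simp add: sum_distrib_left mult.commute)
  finally show ?thesis by (simp add: coeff_sum mult.commute)
qed

lemma jury_mat_mult_vec_coeff:
  assumes "degree U < d" "k < d"
  shows "(jury_mat f d *\<^sub>v vec d (coeff U)) $ k = coeff (f * U) k - coeff (f * U) (2 * d - k)"
  using assms(2)
  by (simp add: jury_mat_def scalar_prod_def coeff_mult_eq_sum_monom[OF assms(1)]
        left_diff_distrib sum_subtractf atLeast0LessThan)

lemma jury_mat_column_sum_le:
  fixes f :: "'a::real_normed_field poly"
  assumes "m < d"
  shows "(\<Sum>k<d. norm (jury_mat f d $$ (k, m))) \<le> poly_l1_norm f"
proof -
  let ?c = "\<lambda>i. norm (coeff (monom 1 m * f) i)"
  have "(\<Sum>k<d. norm (jury_mat f d $$ (k, m))) \<le> (\<Sum>k<d. ?c k + ?c (2 * d - k))"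
    using assms by (intro sum_mono) (simp add: jury_mat_def norm_triangle_ineq4)
  also have "\<dots> = (\<Sum>k<d. ?c k) + (\<Sum>k\<in>{d<..2 * d}. ?c k)"
    unfolding sum.distrib
    by (intro arg_cong2[where f = "(+)"] refl
          sum.reindex_bij_witness[of _ "\<lambda>k. 2 * d - k" "\<lambda>k. 2 * d - k"]) auto
  also have "\<dots> = (\<Sum>k\<in>{..<d} \<union> {d<..2 * d}. ?c k)"
    by (rule sum.union_disjoint[symmetric]) auto
  also have "\<dots> \<le> poly_l1_norm (monom 1 m * f)"
    by (rule sum_norm_coeff_le_poly_l1_norm) simp
  finally show ?thesis by (simp only: poly_l1_norm_monom_mult)
qed

lemma det_jury_mat_eq_0_obtains:
  fixes f :: "'a::idom poly"
  assumes "det (jury_mat f d) = 0"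
  obtains U where "U \<noteq> 0" "degree U < d" "scaled_palindromic 1 d (f * U)"
proof -
  obtain v where v: "v \<in> carrier_vec d" "v \<noteq> 0\<^sub>v d" "jury_mat f d *\<^sub>v v = 0\<^sub>v d"
    using assms det_0_iff_vec_prod_zero[of "jury_mat f d" d] by auto
  define U where "U = (\<Sum>m<d. monom (v $ m) m)"
  have coeff_U: "coeff U m = (if m < d then v $ m else 0)" for m
    by (auto simp: U_def coeff_sum)
  have v_eq: "v = vec d (coeff U)" using v(1) by (intro eq_vecI) (auto simp: coeff_U)
  have "d > 0" using v(1,2) by (cases d) auto
  then have deg_U: "degree U < d" by (intro degree_lessI) (auto simp: coeff_U)
  have "U \<noteq> 0" using v(2) v_eq by auto
  have "coeff (f * U) k = coeff (f * U) (2 * d - k)" if "k < d" for k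
    using jury_mat_mult_vec_coeff[OF deg_U that, of f] v(3) v_eq that by simp
  then have "scaled_palindromic 1 d (f * U)"
    by (auto simp: scaled_palindromic_def le_less)
  with \<open>U \<noteq> 0\<close> deg_U show thesis by (rule that)
qed

section \<open>The determinant does not vanish without reciprocal roots\<close>

lemma coprime_if_no_common_root:
  fixes p q :: "'a::alg_closed_field poly"
  assumes "\<And>z. poly p z = 0 \<Longrightarrow> poly q z \<noteq> 0"
  shows "coprime p q"
proof (rule coprimeI)
  fix r assume r: "r dvd p" "r dvd q"
  have no_root: "poly r z \<noteq> 0" for z
    using r assms[of z] by (auto simp: dvd_def)
  then have "degree r = 0" using alg_closed_imp_poly_has_root by blast
  moreover have "r \<noteq> 0" using no_root by auto
  ultimately show "is_unit r" by (simp add: is_unit_iff_degree)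
qed

text \<open>The factor \<open>monom 1 e\<close> restores the powers of \<open>x\<close> that \<^const>\<open>reflect_poly\<close> strips.\<close>

lemma palindromic_imp_eq_monom_mult_reflect_poly:
  fixes p :: "'a::comm_semiring_1 poly"
  assumes "degree p \<le> 2 * d" "scaled_palindromic 1 d p"
  obtains e where "p = monom 1 e * reflect_poly p"
proof
  let ?n = "2 * d"
  have lower: "coeff p k = coeff p (?n - k)" if "k \<le> d" for k
    using assms(2) that by (simp add: scaled_palindromic_def)
  have palindromic: "coeff p k = coeff p (?n - k)" if "k \<le> ?n" for k
    using lower[of k] lower[of "?n - k"] that by (cases "k \<le> d") auto
  show "p = monom 1 (?n - degree p) * reflect_poly p"
  proof (rule poly_eqI)
    fix k
    consider "k < ?n - degree p" | "?n - degree p \<le> k" "k \<le> ?n" | "?n < k" by linarith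
    then show "coeff p k = coeff (monom 1 (?n - degree p) * reflect_poly p) k"
    proof cases
      case 1
      then show ?thesis using palindromic[of k] by (simp add: coeff_monom_mult coeff_eq_0)
    next
      case 2
      then have "degree p - (k - (?n - degree p)) = ?n - k" using assms(1) by linarith
      then show ?thesis
        using 2 palindromic[of k] by (simp add: coeff_monom_mult coeff_reflect_poly)
    next
      case 3
      then show ?thesis
        using assms(1) by (simp add: coeff_monom_mult coeff_reflect_poly coeff_eq_0)
    qed
  qed
qed

lemma det_jury_mat_nonzero:
  fixes f :: "'a::{alg_closed_field, field_gcd} poly"
  assumes deg: "degree f = Suc d"
    and roots: "\<And>z. poly f z = 0 \<Longrightarrow> z \<noteq> 0 \<and> poly f (inverse z) \<noteq> 0"
  shows "det (jury_mat f d) \<noteq> 0"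
proof
  assume "det (jury_mat f d) = 0"
  then obtain U where U: "U \<noteq> 0" "degree U < d" "scaled_palindromic 1 d (f * U)"
    using det_jury_mat_eq_0_obtains by blast
  have "degree (f * U) \<le> 2 * d"
    using degree_mult_le[of f U] deg U(2) by linarith
  then obtain e where "f * U = monom 1 e * reflect_poly (f * U)"
    using U(3) palindromic_imp_eq_monom_mult_reflect_poly by blast
  then have "f dvd monom 1 e * reflect_poly f * reflect_poly U"
    by (metis dvd_triv_left mult.assoc reflect_poly_mult)
  moreover have "coprime f (monom 1 e * reflect_poly f)"
    by (rule coprime_if_no_common_root)
       (use roots in \<open>auto simp: poly_monom poly_reflect_poly_nz\<close>)
  ultimately have "f dvd reflect_poly U"
    by (simp add: coprime_dvd_mult_right_iff)
  then have "degree f \<le> degree (reflect_poly U)"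
    using U(1) by (intro dvd_imp_degree_le) auto
  then show False
    using degree_reflect_poly_le[of U] deg U(2) by linarith
qed

section \<open>Scaled reflection\<close>

text \<open>For \<open>t \<noteq> 0\<close> this is \<open>x\<^bsup>n\<^esup> p(t/x)\<close> with \<open>n\<close> the degree of \<open>p\<close>.\<close>

definition scaled_reflect :: "'a::field \<Rightarrow> 'a poly \<Rightarrow> 'a poly" where
  "scaled_reflect t p = reflect_poly (pcompose p [:0, t:])"

lemma scaled_reflect_mult: "scaled_reflect t (p * q) = scaled_reflect t p * scaled_reflect t q"
  by (simp add: scaled_reflect_def pcompose_mult reflect_poly_mult)

lemma coeff_scaled_reflect:
  assumes "t \<noteq> 0"
  shows "coeff (scaled_reflect t p) k
    = (if k \<le> degree p then t ^ (degree p - k) * coeff p (degree p - k) else 0)"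
  using assms
  by (simp add: scaled_reflect_def coeff_reflect_poly coeff_pcompose_linear degree_pcompose)

lemma degree_scaled_reflect:
  assumes "t \<noteq> 0" "coeff p 0 \<noteq> 0"
  shows "degree (scaled_reflect t p) = degree p"
proof -
  have "coeff (pcompose p [:0, t:]) 0 \<noteq> 0" using assms by (simp only: coeff_pcompose_linear) simp
  then show ?thesis using assms(1) by (simp add: scaled_reflect_def degree_pcompose)
qed

lemma scaled_reflect_scaled_reflect:
  assumes "t \<noteq> 0" "coeff p 0 \<noteq> 0"
  shows "scaled_reflect t (scaled_reflect t p) = smult (t ^ degree p) p"
  using assms
  by (intro poly_eqI)
     (auto simp: coeff_scaled_reflect degree_scaled_reflect coeff_eq_0
       simp flip: power_add mult.assoc)

lemma scaled_reflect_quadratic: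
  assumes "\<beta> \<noteq> 0" "\<gamma> \<noteq> 0"
  shows "scaled_reflect (\<beta> * \<gamma>) ([:- \<beta>, 1:] * [:- \<gamma>, 1:])
    = smult (\<beta> * \<gamma>) ([:- \<beta>, 1:] * [:- \<gamma>, 1:])"
  using assms by (simp add: scaled_reflect_def pcompose_pCons reflect_poly_pCons algebra_simps)

lemma scaled_palindromic_multiple_obtains:
  fixes f :: "'a::field poly"
  assumes f: "f = [:- \<beta>, 1:] * [:- \<gamma>, 1:] * h" and "coeff f 0 \<noteq> 0" and deg: "degree f = Suc d"
  obtains U where "U \<noteq> 0" "degree U < d" "scaled_palindromic (\<beta> * \<gamma>) d (f * U)"
proof
  define t where "t = \<beta> * \<gamma>"
  define U where "U = scaled_reflect t h"
  let ?P = "f * U"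
  have nz: "\<beta> \<noteq> 0" "\<gamma> \<noteq> 0" "coeff h 0 \<noteq> 0" "t \<noteq> 0"
    using assms(2) by (auto simp: f t_def coeff_mult_0)
  then have "h \<noteq> 0" by auto
  have d: "d = Suc (degree h)"
    using deg \<open>h \<noteq> 0\<close> unfolding f
    by (simp add: degree_mult_eq del: mult_pCons_left mult_pCons_right)
  have deg_U: "degree U = degree h"
    using nz by (simp add: U_def degree_scaled_reflect)
  then show "degree U < d" by (simp add: d)
  show "U \<noteq> 0"
    using nz \<open>h \<noteq> 0\<close> coeff_scaled_reflect[of t h 0] by (auto simp: U_def)
  have "scaled_reflect t ?P = smult (t ^ d) ?P"
    using scaled_reflect_quadratic[OF nz(1,2)] scaled_reflect_scaled_reflect[OF nz(4,3)]
    unfolding f scaled_reflect_mult U_def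
    by (simp add: d t_def mult_ac del: mult_pCons_left mult_pCons_right)
  moreover have "degree ?P = 2 * d"
    using deg d deg_U \<open>U \<noteq> 0\<close> by (subst degree_mult_eq) auto
  ultimately have P: "t ^ (2 * d - k) * coeff ?P (2 * d - k) = t ^ d * coeff ?P k"
    if "k \<le> 2 * d" for k
    using coeff_scaled_reflect[OF nz(4), of ?P k] that by simp
  show "scaled_palindromic (\<beta> * \<gamma>) d ?P"
    unfolding scaled_palindromic_def
  proof (intro allI impI)
    fix k assume "k \<le> d"
    then have "t ^ (2 * d - k) = t ^ d * t ^ (d - k)"
      by (simp add: mult_2 flip: power_add)
    then show "coeff ?P k = (\<beta> * \<gamma>) ^ (d - k) * coeff ?P (2 * d - k)"
      using P[of k] \<open>k \<le> d\<close> nz(4) by (simp add: t_def)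
  qed
qed

section \<open>The determinant is small if a multiple is scaled palindromic\<close>

lemma sum_diff_eq_choose_two: "(\<Sum>k<d. d - k) = Suc d choose 2"
  by (induction d)
     (simp_all add: sum.lessThan_Suc_shift numeral_2_eq_2 del: sum.lessThan_Suc)

lemma norm_jury_mat_mult_vec_coeff_le:
  fixes f U :: "'a::real_normed_field poly"
  assumes "degree U < d" "k < d" "1 \<le> norm t" "scaled_palindromic t d (f * U)"
    and M: "\<And>i. norm (coeff U i) \<le> M"
  shows "norm ((jury_mat f d *\<^sub>v vec d (coeff U)) $ k)
    \<le> real (d - k) * norm (1 - 1 / t) * (poly_l1_norm f * M)"
proof -
  have "coeff (f * U) k = t ^ (d - k) * coeff (f * U) (2 * d - k)"
    using assms(2,4) by (simp add: scaled_palindromic_def)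
  then have "coeff (f * U) (2 * d - k) = (1 / t) ^ (d - k) * coeff (f * U) k"
    using assms(3) by (auto simp: power_one_over)
  then have "(jury_mat f d *\<^sub>v vec d (coeff U)) $ k
      = (1 ^ (d - k) - (1 / t) ^ (d - k)) * coeff (f * U) k"
    by (simp add: jury_mat_mult_vec_coeff[OF assms(1,2)] left_diff_distrib)
  then have "norm ((jury_mat f d *\<^sub>v vec d (coeff U)) $ k)
      = norm (1 ^ (d - k) - (1 / t) ^ (d - k)) * norm (coeff (f * U) k)"
    by (simp only: norm_mult)
  also have "\<dots> \<le> real (d - k) * norm (1 - 1 / t) * (poly_l1_norm f * M)"
  proof (intro mult_mono norm_power_diff norm_coeff_mult_le M)
    show "norm (1 / t) \<le> 1" using assms(3) by (simp add: norm_divide divide_simps)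
  qed auto
  finally show ?thesis .
qed

lemma norm_det_jury_mat_le:
  fixes f U :: "'a::real_normed_field poly"
  assumes "U \<noteq> 0" "degree U < d" "1 \<le> norm t" "scaled_palindromic t d (f * U)"
  shows "norm (det (jury_mat f d))
    \<le> real (Suc d choose 2) * poly_l1_norm f ^ d * norm (1 - 1 / t)"
proof -
  let ?L = "poly_l1_norm f" and ?T = "jury_mat f d" and ?v = "vec d (coeff U)"
  obtain j where "j \<le> degree U" and j_max: "\<And>i. norm (coeff U i) \<le> norm (coeff U j)"
    using obtains_coeff_of_maximal_norm[of U] by blast
  then have j: "j < d" using assms(2) by simp
  let ?M = "norm (coeff U j)"
  have "0 < norm (lead_coeff U)" using assms(1) by simp
  also have "\<dots> \<le> ?M" by (rule j_max)
  finally have "?M > 0" .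
  have "?M * norm (det ?T) \<le> (\<Sum>k<d. norm ((?T *\<^sub>v ?v) $ k)) * ?L ^ (d - 1)"
    using norm_vec_index_mult_det_le[OF jury_mat_carrier _ j jury_mat_column_sum_le, of ?v] j
    by simp
  also have "\<dots> \<le> (\<Sum>k<d. real (d - k) * norm (1 - 1 / t) * (?L * ?M)) * ?L ^ (d - 1)"
    using norm_jury_mat_mult_vec_coeff_le[OF assms(2) _ assms(3,4) j_max]
    by (intro mult_right_mono sum_mono zero_le_power) (auto simp: poly_l1_norm_def sum_nonneg)
  also have "\<dots> = ?M * (real (\<Sum>k<d. d - k) * (?L * ?L ^ (d - 1)) * norm (1 - 1 / t))"
    by (simp only: of_nat_sum sum_distrib_left sum_distrib_right mult_ac)
  also have "?L * ?L ^ (d - 1) = ?L ^ d"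
    using j by (simp flip: power_Suc)
  finally show ?thesis
    using \<open>?M > 0\<close> by (simp only: sum_diff_eq_choose_two mult_le_cancel_left_pos)
qed

section \<open>Roots of expansive integer polynomials\<close>

lemma expansive_imp_coeff_0_nonzero: "expansive f \<Longrightarrow> coeff f 0 \<noteq> 0"
  by (auto simp: expansive_def simp flip: poly_0_coeff_0)

lemma expansive_imp_no_reciprocal_roots:
  assumes "expansive f" "poly f z = 0"
  shows "z \<noteq> 0 \<and> poly f (inverse z) \<noteq> 0"
proof -
  have "norm z > 1" using assms by (simp add: expansive_def)
  then have "z \<noteq> 0" "norm (inverse z) < 1" by (auto simp: norm_inverse inverse_less_1_iff)
  then show ?thesis using assms(1) by (auto simp: expansive_def dest: less_asym)
qed

lemma inverse_gap_le:
  fixes r c :: real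
  assumes "r > 1" "1 \<le> c * (1 - 1 / r)"
  shows "1 / (r - 1) \<le> c"
proof -
  have "r \<le> c * (r - 1)" using assms by (simp add: field_simps)
  then show ?thesis using assms by (simp add: pos_divide_le_eq)
qed

lemma inverse_gap_eq_inverse_square_gap:
  fixes r :: real
  assumes "r > 1"
  shows "1 / (r - 1) = 2 * (1 / (r\<^sup>2 - 1)) + 1 / (r + 1)"
proof -
  have "r\<^sup>2 - 1 = (r - 1) * (r + 1)" by (simp add: power2_eq_square algebra_simps)
  then show ?thesis using assms by (simp add: divide_simps) (simp add: algebra_simps)
qed

lemma real_root_gap_le:
  fixes f :: "int poly" and x :: real
  assumes exp: "expansive (map_poly of_int f)"
    and root: "poly (map_poly of_int f) (of_real x) = (0::complex)"
  shows "1 / (\<bar>x\<bar> - 1) \<le> real (degree f) * poly_length f"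
proof (rule inverse_gap_le)
  define F where "F = (map_poly of_int f :: complex poly)"
  define \<sigma> where "\<sigma> = (if x > 0 then 1 else - 1 :: int)"
  show x1: "\<bar>x\<bar> > 1" using exp root by (auto simp: expansive_def)
  have "reflect_poly F = map_poly of_int (reflect_poly f)"
    by (rule poly_eqI) (simp add: F_def coeff_reflect_poly coeff_map_poly degree_map_poly)
  then have int: "poly (reflect_poly F) (of_int \<sigma>) = of_int (poly (reflect_poly f) \<sigma>)"
    by (simp add: poly_altdef coeff_map_poly degree_map_poly)
  have "poly F (of_int \<sigma>) \<noteq> 0"
    using exp[unfolded expansive_def, rule_format, of "of_int \<sigma>"] by (auto simp: F_def \<sigma>_def)
  then have "poly (reflect_poly F) (of_int \<sigma>) \<noteq> 0"
    by (auto simp: poly_reflect_poly_nz \<sigma>_def split: if_splits)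
  then have "1 \<le> norm (poly (reflect_poly F) (of_int \<sigma>))"
    unfolding int by simp
  also have "\<dots> = norm (poly (reflect_poly F) (of_int \<sigma>)
      - poly (reflect_poly F) (inverse (of_real x)))"
    using root x1 by (simp add: poly_reflect_poly_nz F_def)
  also have "\<dots> \<le> real (degree (reflect_poly F)) * poly_l1_norm (reflect_poly F)
      * norm (of_int \<sigma> - inverse (of_real x) :: complex)"
    using x1 by (intro norm_poly_diff_le) (auto simp: \<sigma>_def norm_inverse inverse_le_1_iff)
  also have "of_int \<sigma> - inverse (of_real x) = (of_real (of_int \<sigma> - 1 / x) :: complex)"
    by (simp add: inverse_eq_divide)
  also have "norm \<dots> = \<bar>of_int \<sigma> - 1 / x\<bar>"
    by (rule norm_of_real)
  also have "\<dots> = 1 - 1 / \<bar>x\<bar>"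
    using x1 by (auto simp: \<sigma>_def field_simps abs_if)
  also have "poly_l1_norm (reflect_poly F) = poly_length f"
    by (simp add: poly_l1_norm_reflect_poly F_def poly_l1_norm_map_poly_of_int)
  also have "degree (reflect_poly F) = degree f"
    using expansive_imp_coeff_0_nonzero[OF exp] by (simp add: F_def degree_map_poly)
  finally show "1 \<le> real (degree f) * poly_length f * (1 - 1 / \<bar>x\<bar>)" .
qed

lemma nonreal_conjugate_factorization:
  fixes f :: "real poly"
  assumes root: "poly (map_poly of_real f) \<alpha> = (0::complex)" and "\<alpha> \<notin> \<real>"
  obtains h where "map_poly of_real f = [:- \<alpha>, 1:] * [:- cnj \<alpha>, 1:] * h"
proof -
  let ?F = "map_poly complex_of_real f"
  obtain g where g: "?F = [:- \<alpha>, 1:] * g"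
    using root by (metis dvdE poly_eq_0_iff_dvd)
  have "poly ?F (cnj \<alpha>) = cnj (poly ?F \<alpha>)"
    by (simp add: poly_altdef coeff_map_poly)
  then have "poly ?F (cnj \<alpha>) = 0" using root by simp
  moreover have "cnj \<alpha> \<noteq> \<alpha>" using \<open>\<alpha> \<notin> \<real>\<close> by (simp add: Reals_cnj_iff)
  ultimately have "poly g (cnj \<alpha>) = 0" by (simp add: g)
  then obtain h where "g = [:- cnj \<alpha>, 1:] * h"
    by (metis dvdE poly_eq_0_iff_dvd)
  then show thesis using g that[of h] by (simp only: mult.assoc)
qed

lemma one_le_norm_det_jury_mat_if_expansive:
  fixes f :: "int poly"
  assumes "degree f = Suc d" "expansive (map_poly of_int f)"
  shows "1 \<le> norm (det (jury_mat (map_poly of_int f) d) :: complex)"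
proof -
  have "det (jury_mat (map_poly of_int f) d) \<noteq> (0 :: complex)"
    using assms
    by (intro det_jury_mat_nonzero expansive_imp_no_reciprocal_roots) (auto simp: degree_map_poly)
  then show ?thesis by (simp add: jury_mat_map_poly_of_int)
qed

lemma nonreal_root_square_gap_le:
  fixes f :: "int poly" and \<alpha> :: complex
  assumes deg: "degree f = Suc d" and exp: "expansive (map_poly of_int f)"
    and root: "poly (map_poly of_int f) \<alpha> = 0" and "\<alpha> \<notin> \<real>"
  shows "1 / ((norm \<alpha>)\<^sup>2 - 1) \<le> real (Suc d choose 2) * real_of_int (poly_length f) ^ d"
proof (rule inverse_gap_le)
  define F where "F = (map_poly of_int f :: complex poly)"
  have "norm \<alpha> > 1" using exp root by (simp add: expansive_def)
  then show gap: "(norm \<alpha>)\<^sup>2 > 1" by simp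
  have "F = map_poly of_real (map_poly of_int f)"
    by (simp add: F_def map_poly_map_poly o_def)
  then obtain h where "F = [:- \<alpha>, 1:] * [:- cnj \<alpha>, 1:] * h"
    using nonreal_conjugate_factorization root \<open>\<alpha> \<notin> \<real>\<close> by (metis F_def)
  moreover have "coeff F 0 \<noteq> 0"
    unfolding F_def by (rule expansive_imp_coeff_0_nonzero[OF exp])
  moreover have "degree F = Suc d"
    by (simp add: F_def degree_map_poly deg)
  ultimately obtain U where U: "U \<noteq> 0" "degree U < d" "scaled_palindromic (\<alpha> * cnj \<alpha>) d (F * U)"
    using scaled_palindromic_multiple_obtains by blast
  have "1 \<le> norm (det (jury_mat F d))"
    unfolding F_def by (rule one_le_norm_det_jury_mat_if_expansive[OF deg exp])
  also have "\<dots> \<le> real (Suc d choose 2) * poly_l1_norm F ^ d * norm (1 - 1 / (\<alpha> * cnj \<alpha>))"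
    using gap U by (intro norm_det_jury_mat_le) (auto simp: norm_mult power2_eq_square)
  also have "1 - 1 / (\<alpha> * cnj \<alpha>) = of_real (1 - 1 / (norm \<alpha>)\<^sup>2)"
    by (simp flip: complex_norm_square)
  also have "norm \<dots> = 1 - 1 / (norm \<alpha>)\<^sup>2"
    using gap by (subst norm_of_real) (simp add: divide_simps)
  also have "poly_l1_norm F = poly_length f"
    by (simp add: F_def poly_l1_norm_map_poly_of_int)
  finally show "1 \<le> real (Suc d choose 2) * real_of_int (poly_length f) ^ d
      * (1 - 1 / (norm \<alpha>)\<^sup>2)" .
qed

theorem theorem4p6:
  fixes f :: "int poly" and n :: nat and \<alpha> :: complex
  assumes "degree f = n" and "n \<ge> 1"
    and "expansive (map_poly of_int f)"
    and "poly (map_poly of_int f) \<alpha> = 0"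
  shows "1 / (norm \<alpha> - 1) \<le>
    (if \<alpha> \<in> \<real>
     then real n * real_of_int (poly_length f) + real n
     else 2 * real (n choose 2) * real_of_int (poly_length f) ^ (n - 1)
            + 2 * real (n choose 2) + 1)"
proof (cases "\<alpha> \<in> \<real>")
  case True
  then obtain x where "\<alpha> = of_real x" by (rule Reals_cases)
  then have "1 / (norm \<alpha> - 1) \<le> real n * poly_length f"
    using real_root_gap_le[of f x] assms by simp
  then show ?thesis using True by simp
next
  case False
  let ?N = "real (n choose 2) * real_of_int (poly_length f) ^ (n - 1)"
  have "norm \<alpha> > 1" using assms by (simp add: expansive_def)
  then have "1 / (norm \<alpha> - 1) = 2 * (1 / ((norm \<alpha>)\<^sup>2 - 1)) + 1 / (norm \<alpha> + 1)"
    by (rule inverse_gap_eq_inverse_square_gap)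
  also have "\<dots> \<le> 2 * ?N + 1"
  proof (intro add_mono mult_left_mono)
    show "1 / ((norm \<alpha>)\<^sup>2 - 1) \<le> ?N"
      using nonreal_root_square_gap_le[of f "n - 1" \<alpha>] assms False by simp
    show "1 / (norm \<alpha> + 1) \<le> 1" using \<open>norm \<alpha> > 1\<close> by simp
  qed simp
  finally show ?thesis using False by simp
qed

end
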